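(* Let $b\ge 1$ be an integer. For each integer $n\ge 1$, $$\overline{S}_b(n)=2b\sum_{k=0}^{\left\lfloor \frac{n-b}{2b}\right\rfloor}\overline{p}\bigl(n-(2k+1)b\bigr),$$ where the sum is empty (equal to $0$) if its upper limit is negative.
   Context: An overpartition of a nonnegative integer $n$ is a partition of $n$ in which the first occurrence of each distinct part may be overlined (or not). $\overline{p}(n)$ is the number of overpartitions of $n$, with $\overline{p}(0)=1$. $\overline{S}_b(n)$ denotes the sum of all parts equal to $b$ (overlined or not, counted with multiplicity) appearing in all overpartitions of $n$. *)

theory Defs
  imports Complex_Main "HOL-Library.Multiset"
begin

text \<open>
  At most one occurrence of each distinct part (the first one) may be overlined. An overpartition
  is therefore a pair \<open>(M, A)\<close>: \<open>M\<close> is the multiset of all parts, overlined or not,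
  and \<open>A\<close> is the set of those distinct parts whose first occurrence is overlined.
\<close>

definition overpartitions :: "nat \<Rightarrow> (nat multiset \<times> nat set) set" where
  "overpartitions n = {(M, A). (\<forall>x\<in>#M. x > 0) \<and> \<Sum>\<^sub># M = n \<and> A \<subseteq> set_mset M}"

definition pbar :: "nat \<Rightarrow> nat" where
  "pbar n = card (overpartitions n)"

definition Sbar :: "nat \<Rightarrow> nat \<Rightarrow> nat" where
  "Sbar b n = (\<Sum>(M, A)\<in>overpartitions n. \<Sum>\<^sub># {#x \<in># M. x = b#})"

text \<open>
  Cardinalities and sums over infinite sets are 0 by convention; this never applies here:
\<close>

lemma finite_overpartitions: "finite (overpartitions n)"
proof -
  have sz: "(\<forall>x\<in>#M. x > 0) \<Longrightarrow> size M \<le> \<Sum>\<^sub># M" for M :: "nat multiset"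
    by (induction M) auto
  have "overpartitions n \<subseteq> (\<Union>k\<in>{..n}. multisets_of_size {..n} k) \<times> Pow {..n}"
  proof
    fix p assume p: "p \<in> overpartitions n"
    obtain M A where [simp]: "p = (M, A)" by (cases p)
    from p have M: "\<forall>x\<in>#M. x > 0" "\<Sum>\<^sub># M = n" and A: "A \<subseteq> set_mset M"
      by (auto simp: overpartitions_def)
    have "x \<le> n" if "x \<in># M" for x
      using M(2) multi_member_split[OF that] by auto
    then have sub: "set_mset M \<subseteq> {..n}" by auto
    have "size M \<le> n" using sz[OF M(1)] M(2) by simp
    then show "p \<in> (\<Union>k\<in>{..n}. multisets_of_size {..n} k) \<times> Pow {..n}"
      using sub A by (simp add: multisets_of_size_def)
  qed
  moreover have "finite ((\<Union>k\<in>{..n}. multisets_of_size {..n} k) \<times> Pow {..n})"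
    by (intro finite_cartesian_product finite_UN_I finite_multisets_of_size) auto
  ultimately show ?thesis
    by (rule finite_subset)
qed

lemma pbar_0: "pbar 0 = 1"
proof -
  have "M = {#}" if "\<forall>x\<in>#M. x > 0" "\<Sum>\<^sub># M = 0" for M :: "nat multiset"
    using that by (cases M) auto
  then have "overpartitions 0 = {({#}, {})}"
    unfolding overpartitions_def by fastforce
  then show ?thesis by (simp add: pbar_def)
qed

end

theory Submission
  imports Defs
begin

text \<open>
  Let \<open>F(m)\<close> count the overpartitions of \<open>m\<close> in which \<open>b\<close> is not overlined (it may still occur
  plainly), and let \<open>W(m)\<close> be the total number of copies of \<open>b\<close> in them; both are read as \<open>0\<close> at
  negative arguments. Removing one copy of \<open>b\<close> gives all the recurrences needed.

  Removing the overlined \<open>b\<close> identifies the overpartitions of \<open>m\<close> with \<open>b\<close> overlined with those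
  of \<open>m - b\<close> counted by \<open>F\<close>; hence \<open>pbar m = F(m) + F(m - b)\<close>. Removing a plain \<open>b\<close> from an
  overpartition without overlined \<open>b\<close> lands in the same set, so \<open>W(m) = W(m - b) + F(m - b)\<close>.
  Finally, the overpartitions that contain \<open>b\<close> split evenly according to whether \<open>b\<close> is
  overlined, with the same multiplicities, so all overpartitions of \<open>m\<close> together contain
  \<open>2 W(m)\<close> copies of \<open>b\<close>.

  Two steps of the recurrence for \<open>W\<close> pair up consecutive values of \<open>F\<close>:
  \<open>W(m) = W(m - 2 b) + F(m - 2 b) + F(m - b) = W(m - 2 b) + pbar (m - b)\<close>. Unfolding this yields
  \<open>pbar\<close> at \<open>m - b\<close>, \<open>m - 3 b\<close>, \<open>m - 5 b\<close>, \<open>\<dots>\<close>, which is the sum in the theorem; the factor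
  \<open>2 b\<close> comes from the two choices of overlining and from the size of each copy.
\<close>

definition overpartitions_not_overlining :: "nat \<Rightarrow> nat \<Rightarrow> (nat multiset \<times> nat set) set" where
  "overpartitions_not_overlining b n = {(M, A) \<in> overpartitions n. b \<notin> A}"

lemma finite_overpartitions_not_overlining: "finite (overpartitions_not_overlining b n)"
  unfolding overpartitions_not_overlining_def
  by (rule finite_subset[OF _ finite_overpartitions[of n]]) auto

lemma in_diff_singleton_neq: "x \<in># M \<Longrightarrow> x \<noteq> b \<Longrightarrow> x \<in># M - {#b#}"
  by (simp add: in_diff_count)

lemma part_le_of_overpartition:
  assumes "(M, A) \<in> overpartitions n" and "b \<in># M"
  shows "b \<le> n"
  using assms multi_member_split[of b M] by (auto simp: overpartitions_def)

lemma count_overpartition_eq_0: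
  assumes "(M, A) \<in> overpartitions n" and "n < b"
  shows "count M b = 0"
  using part_le_of_overpartition[OF assms(1), of b] assms(2) by (auto simp: count_eq_zero_iff)

text \<open>
  Summing an arbitrary weight \<open>g\<close> instead of counting lets the same bijection serve both for
  \<open>pbar\<close> (weight \<open>1\<close>) and for the number of copies of \<open>b\<close> (weight \<open>count M b\<close>). The second
  sum on the right accounts for the overpartitions in which \<open>b\<close> is overlined: deleting that
  overlined part leaves one in which \<open>b\<close> is not overlined.
\<close>

lemma sum_overpartitions_split:
  fixes g :: "nat multiset \<Rightarrow> nat"
  assumes "b > 0" and "b \<le> n"
  shows "(\<Sum>(M, A)\<in>overpartitions n. g M) =
    (\<Sum>(M, A)\<in>overpartitions_not_overlining b n. g M) +
    (\<Sum>(M, A)\<in>overpartitions_not_overlining b (n - b). g (add_mset b M))"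
proof -
  let ?O = "{(M, A) \<in> overpartitions n. b \<in> A}"
  have fin: "finite ?O"
    by (rule finite_subset[OF _ finite_overpartitions[of n]]) auto
  have union: "overpartitions_not_overlining b n \<union> ?O = overpartitions n"
    by (auto simp: overpartitions_not_overlining_def)
  have disjoint: "overpartitions_not_overlining b n \<inter> ?O = {}"
    by (auto simp: overpartitions_not_overlining_def)
  have "(\<Sum>(M, A)\<in>overpartitions n. g M) =
      (\<Sum>(M, A)\<in>overpartitions_not_overlining b n. g M) + (\<Sum>(M, A)\<in>?O. g M)"
    using sum.union_disjoint[OF finite_overpartitions_not_overlining fin disjoint]
    unfolding union .
  moreover have "(\<Sum>(M, A)\<in>?O. g M) =
      (\<Sum>(M, A)\<in>overpartitions_not_overlining b (n - b). g (add_mset b M))"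
    by (rule sum.reindex_bij_witness[where
          i = "\<lambda>(M, A). (add_mset b M, insert b A)" and j = "\<lambda>(M, A). (M - {#b#}, A - {b})"])
      (use assms in \<open>auto simp: overpartitions_not_overlining_def overpartitions_def
          sum_mset_diff subset_iff dest: in_diffD intro: in_diff_singleton_neq\<close>)
  ultimately show ?thesis by simp
qed

text \<open>
  The plain counterpart: among overpartitions without overlined \<open>b\<close>, only those containing \<open>b\<close>
  carry weight, and deleting one plain copy of \<open>b\<close> from these is a bijection.
\<close>

lemma sum_not_overlining_shift:
  fixes g :: "nat multiset \<Rightarrow> nat"
  assumes "b > 0" and "b \<le> n" and zero: "\<And>M. b \<notin># M \<Longrightarrow> g M = 0"
  shows "(\<Sum>(M, A)\<in>overpartitions_not_overlining b n. g M) =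
    (\<Sum>(M, A)\<in>overpartitions_not_overlining b (n - b). g (add_mset b M))"
proof -
  let ?C = "{(M, A) \<in> overpartitions_not_overlining b n. b \<in># M}"
  have "(\<Sum>(M, A)\<in>overpartitions_not_overlining b n. g M) = (\<Sum>(M, A)\<in>?C. g M)"
    by (rule sum.mono_neutral_right)
      (auto simp: finite_overpartitions_not_overlining, metis zero less_irrefl)
  also have "\<dots> = (\<Sum>(M, A)\<in>overpartitions_not_overlining b (n - b). g (add_mset b M))"
    by (rule sum.reindex_bij_witness[where
          i = "\<lambda>(M, A). (add_mset b M, A)" and j = "\<lambda>(M, A). (M - {#b#}, A)"])
      (use assms in \<open>auto simp: overpartitions_not_overlining_def overpartitions_def
          sum_mset_diff subset_iff dest: in_diffD intro: in_diff_singleton_neq\<close>)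
  finally show ?thesis .
qed

definition copies_not_overlining :: "nat \<Rightarrow> nat \<Rightarrow> nat" where
  "copies_not_overlining b n = (\<Sum>(M, A)\<in>overpartitions_not_overlining b n. count M b)"

lemma copies_not_overlining_eq_0:
  assumes "n < b"
  shows "copies_not_overlining b n = 0"
  unfolding copies_not_overlining_def overpartitions_not_overlining_def
  by (rule sum.neutral) (use assms count_overpartition_eq_0 in auto)

lemma pbar_eq_card_not_overlining:
  assumes "b > 0" and "b \<le> n"
  shows "pbar n = card (overpartitions_not_overlining b n) +
    card (overpartitions_not_overlining b (n - b))"
  using sum_overpartitions_split[OF assms, of "\<lambda>_. 1"] by (simp add: pbar_def)

lemma pbar_eq_card_not_overlining_small:
  assumes "n < b"
  shows "pbar n = card (overpartitions_not_overlining b n)"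
proof -
  have "overpartitions_not_overlining b n = overpartitions n"
    using assms part_le_of_overpartition
    by (fastforce simp: overpartitions_not_overlining_def overpartitions_def)
  then show ?thesis by (simp add: pbar_def)
qed

lemma sum_count_add_mset:
  "(\<Sum>(M, A)\<in>overpartitions_not_overlining b n. count (add_mset b M) b) =
    copies_not_overlining b n + card (overpartitions_not_overlining b n)"
  unfolding copies_not_overlining_def by (simp add: case_prod_unfold sum.distrib sum_Suc)

lemma copies_not_overlining_step:
  assumes "b > 0" and "b \<le> n"
  shows "copies_not_overlining b n =
    copies_not_overlining b (n - b) + card (overpartitions_not_overlining b (n - b))"
  using sum_not_overlining_shift[OF assms, of "\<lambda>M. count M b"] sum_count_add_mset[of b "n - b"]
  by (simp add: copies_not_overlining_def count_eq_zero_iff)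

text \<open>
  Whether \<open>b\<close> is overlined or plain, deleting one copy of it leads to the same set of
  overpartitions of \<open>n - b\<close> with the same weight \<open>count M b + 1\<close>; hence the factor \<open>2\<close>.
\<close>

lemma sum_count_overpartitions:
  assumes "b > 0"
  shows "(\<Sum>(M, A)\<in>overpartitions n. count M b) = 2 * copies_not_overlining b n"
proof (cases "b \<le> n")
  case True
  show ?thesis
    using sum_overpartitions_split[OF assms True, of "\<lambda>M. count M b"]
      sum_count_add_mset[of b "n - b"] copies_not_overlining_step[OF assms True]
    by (simp add: copies_not_overlining_def)
next
  case False
  then have "(\<Sum>(M, A)\<in>overpartitions n. count M b) = 0"
    by (intro sum.neutral) (auto intro: count_overpartition_eq_0)
  then show ?thesis using False by (simp add: copies_not_overlining_eq_0)
qed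

text \<open>
  Two steps of the recurrence contribute \<open>F(n - b) + F(n - 2 b) = pbar (n - b)\<close>, where \<open>F\<close>
  counts overpartitions without overlined \<open>b\<close>. For \<open>b \<le> n < 2 b\<close> the second step is missing,
  but then \<open>b\<close> is too large to occur in an overpartition of \<open>n - b\<close> and \<open>F(n - b)\<close> alone is
  \<open>pbar (n - b)\<close>.
\<close>

lemma copies_not_overlining_eq_sum_pbar:
  assumes "b > 0"
  shows "copies_not_overlining b n = (\<Sum>k | (2 * k + 1) * b \<le> n. pbar (n - (2 * k + 1) * b))"
proof (induction n rule: less_induct)
  case (less n)
  consider "n < b" | "b \<le> n" "n < 2 * b" | "2 * b \<le> n" by linarith
  then show ?case
  proof cases
    case 1
    then have "{k. (2 * k + 1) * b \<le> n} = {}" by auto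
    then show ?thesis using 1 by (simp add: copies_not_overlining_eq_0)
  next
    case 2
    have "k = 0" if "(2 * k + 1) * b \<le> n" for k
    proof (rule ccontr)
      assume "k \<noteq> 0"
      then have "2 * b \<le> (2 * k + 1) * b" by (intro mult_right_mono) auto
      with that 2 show False by (meson leD le_trans)
    qed
    then have "{k. (2 * k + 1) * b \<le> n} = {0}" using 2 by auto
    then show ?thesis
      using 2 assms copies_not_overlining_step[of b n] copies_not_overlining_eq_0[of "n - b" b]
        pbar_eq_card_not_overlining_small[of "n - b" b] by simp
  next
    case 3
    have "finite {k. (2 * k + 1) * b \<le> n - 2 * b}"
    proof (rule finite_subset)
      show "{k. (2 * k + 1) * b \<le> n - 2 * b} \<subseteq> {..n}"
      proof
        fix k assume "k \<in> {k. (2 * k + 1) * b \<le> n - 2 * b}"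
        moreover have "k * 1 \<le> (2 * k + 1) * b" using assms by (intro mult_mono) auto
        ultimately show "k \<in> {..n}" by simp
      qed
    qed simp
    \<comment> \<open>The term for \<open>k = 0\<close> comes from the two steps; the others come from \<open>n - 2 b\<close> with
      \<open>k\<close> shifted by one.\<close>
    moreover have "{k. (2 * k + 1) * b \<le> n} =
        insert 0 (Suc ` {k. (2 * k + 1) * b \<le> n - 2 * b})"
    proof (rule set_eqI)
      fix k
      show "k \<in> {k. (2 * k + 1) * b \<le> n} \<longleftrightarrow>
          k \<in> insert 0 (Suc ` {k. (2 * k + 1) * b \<le> n - 2 * b})"
        using 3 by (cases k) (auto simp: algebra_simps)
    qed
    ultimately have "(\<Sum>k | (2 * k + 1) * b \<le> n. pbar (n - (2 * k + 1) * b)) =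
        pbar (n - b) + (\<Sum>k | (2 * k + 1) * b \<le> n - 2 * b. pbar (n - (2 * Suc k + 1) * b))"
      by (simp add: sum.reindex)
    also have "(\<Sum>k | (2 * k + 1) * b \<le> n - 2 * b. pbar (n - (2 * Suc k + 1) * b)) =
        copies_not_overlining b (n - 2 * b)"
      using less.IH[of "n - 2 * b"] 3 assms by (simp add: algebra_simps)
    also have "pbar (n - b) + copies_not_overlining b (n - 2 * b) = copies_not_overlining b n"
      using 3 assms copies_not_overlining_step[of b n] copies_not_overlining_step[of b "n - b"]
        pbar_eq_card_not_overlining[of b "n - b"] by (simp flip: mult_2)
    finally show ?thesis by simp
  qed
qed

lemma Sbar_eq_sum_count: "Sbar b n = b * (\<Sum>(M, A)\<in>overpartitions n. count M b)"
  unfolding Sbar_def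
  by (simp add: filter_eq_replicate_mset sum_distrib_left case_prod_unfold mult.commute)

theorem theorem6:
  fixes b n :: nat
  assumes "b \<ge> 1" and "n \<ge> 1"
  shows "Sbar b n =
    2 * b * (\<Sum>k | int k \<le> \<lfloor>(real n - real b) / (2 * real b)\<rfloor>. pbar (n - (2 * k + 1) * b))"
proof -
  have "int k \<le> \<lfloor>(real n - real b) / (2 * real b)\<rfloor> \<longleftrightarrow> (2 * k + 1) * b \<le> n" for k
  proof -
    have "int k \<le> \<lfloor>(real n - real b) / (2 * real b)\<rfloor> \<longleftrightarrow>
        real k \<le> (real n - real b) / (2 * real b)"
      by (simp add: le_floor_iff)
    also have "\<dots> \<longleftrightarrow> real ((2 * k + 1) * b) \<le> real n"
      using assms by (simp add: field_simps)
    finally show ?thesis by (simp only: of_nat_le_iff)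
  qed
  then show ?thesis
    using assms sum_count_overpartitions[of b n] copies_not_overlining_eq_sum_pbar[of b n]
    by (simp add: Sbar_eq_sum_count)
qed

end
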